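(* Let $\lambda$ be a partition, $\pi$ a reverse plane partition of shape $\lambda$ and $h$ a rim-hook of $\lambda$ that does not insert into $\pi$. Then there exists a candidate $u\in\mathrm{cand}(\pi)$ with $u\triangleleft\alpha(P(h,\pi))$.
   Context: Cells are pairs $(i,j)\in\mathbb Z^2$; $\mathrm n(i,j)=(i-1,j)$, $\mathrm e(i,j)=(i,j+1)$, $\mathrm s(i,j)=(i+1,j)$, $\mathrm w(i,j)=(i,j-1)$. A partition $\lambda$ is identified with its Young diagram. A reverse plane partition of shape $\lambda$ is $\pi:\lambda\to\mathbb N$ with $\pi(u)\le\pi(\mathrm e u),\pi(\mathrm s u)$, with conventions $\pi(i,j)=0$ if $i\le0$ or $j\le0$, $\pi(i,j)=\infty$ if $i,j\ge1$, $(i,j)\notin\lambda$. Content $c(i,j)=j-i$; outer corner: $u\in\lambda$, $\mathrm e u,\mathrm s u\notin\lambda$; inner corner: $\mathrm e u,\mathrm s u\in\lambda$, $\mathrm e\mathrm s u\notin\lambda$. With inner corner contents $i_1<\dots<i_r$ and outer corner contents $o_1<\dots<o_{r+1}$ (interlacing), $\mathcal I=\{u\in\lambda:c(u)=i_k\}$, $\mathcal O=\{u\in\lambda:c(u)=o_k\}$, $\mathcal A=\{u\in\lambda:c(u)<o_1\text{ or }i_k<c(u)<o_{k+1}\text{ for some }k\in[r]\}$, $\mathcal B=\{u\in\lambda:o_k<c(u)<i_k\text{ for some }k\in[r]\text{ or }c(u)>o_{r+1}\}$. Content order: $(i,j)\trianglelefteq(k,l)$ iff $j-i>l-k$, or $j-i=l-k$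 and $i\ge k$; $\triangleleft$ is the strict version. Candidates: $\mathrm{cand}(\pi)=\{u\in\mathcal O:\pi(u)>\pi(\mathrm w u)\}\cup\{u\in\mathcal A:\pi(u)>\pi(\mathrm w u),\pi(u)>\pi(\mathrm n u)\}$. North-east path: $(u_0,\dots,u_s)$ in $\lambda$ with $u_k\in\{\mathrm n u_{k-1},\mathrm e u_{k-1}\}$, length $s$, head $\alpha=u_0$, tail $\omega=u_s$. South-west path: $(v_0,\dots,v_s)$ with $v_k\in\{\mathrm s v_{k-1},\mathrm w v_{k-1}\}$, length $s$, $\alpha=v_s$, $\omega=v_0$. Rim-hook of $\lambda$: north-east path $h$ with $\mathrm s\alpha(h)\notin\lambda$, $\mathrm e\omega(h)\notin\lambda$, $\mathrm e\mathrm s u\notin\lambda$ for all $u\in h$. $(\pi+P)(u)=\pi(u)+1$ for $u\in P$, else $\pi(u)$. $(P,\pi)$ compatible: $u\in P\cap(\mathcal I\cup\mathcal A)$ implies $\mathrm e u\in P$ and $\pi(u)=\pi(\mathrm e u)$; $u,\mathrm s u\in P$ implies $\pi(u)=\pi(\mathrm s u)$. $h$ inserts into $\pi$ if some path $P$ has $\omega(P)=\omega(h)$, $\ell(P)=\ell(h)$, $(P,\pi)$ compatible and $\pi+P$ a reverse plane partition. $P(h,\pi)$: the south-west path starting at $\omega(h)$ which, while its length is less than $\ell(h)$, moves from current cell $u$ to $\mathrm s u$ if $u\in\mathcal B\cup\mathcal I$ and $\pi(u)=\pi(\mathrm s u)$, and to $\mathrm w u$ otherwise. *)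

theory Defs
  imports Main "HOL-Library.Extended_Nat"
begin

type_synonym cell = "int \<times> int"

text \<open>Matrix coordinates: the first entry is the row (growing southwards), the second the column.\<close>

definition north :: "cell \<Rightarrow> cell" where "north u = (fst u - 1, snd u)"
definition east  :: "cell \<Rightarrow> cell" where "east u = (fst u, snd u + 1)"
definition south :: "cell \<Rightarrow> cell" where "south u = (fst u + 1, snd u)"
definition west  :: "cell \<Rightarrow> cell" where "west u = (fst u, snd u - 1)"

definition content :: "cell \<Rightarrow> int" where
  "content u = snd u - fst u"

definition is_partition :: "nat list \<Rightarrow> bool" where
  "is_partition ls \<longleftrightarrow> sorted_wrt (\<ge>) ls \<and> 0 \<notin> set ls"

text \<open>Rows and columns are numbered from 1, while list positions start at 0.\<close>

definition diagram :: "nat list \<Rightarrow> cell set" where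
  "diagram ls = {(i, j). 1 \<le> i \<and> i \<le> int (length ls) \<and> 1 \<le> j \<and> j \<le> int (ls ! nat (i - 1))}"

definition inner_corner :: "nat list \<Rightarrow> cell \<Rightarrow> bool" where
  "inner_corner ls u \<longleftrightarrow>
     east u \<in> diagram ls \<and> south u \<in> diagram ls \<and> east (south u) \<notin> diagram ls"

definition outer_corner :: "nat list \<Rightarrow> cell \<Rightarrow> bool" where
  "outer_corner ls u \<longleftrightarrow>
     u \<in> diagram ls \<and> east u \<notin> diagram ls \<and> south u \<notin> diagram ls"

text \<open>
  The increasing lists of corner contents. With \<open>r\<close> inner corners, the contents
  \<open>i\<^sub>1 < \<dots> < i\<^sub>r\<close> are the entries \<open>0, \<dots>, r - 1\<close> of the first list, and
  \<open>o\<^sub>1 < \<dots> < o\<^sub>r\<^sub>+\<^sub>1\<close> are the entries \<open>0, \<dots>, r\<close> of the second one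
  (for a nonempty diagram).
\<close>

definition inner_contents :: "nat list \<Rightarrow> int list" where
  "inner_contents ls = sorted_list_of_set (content ` {u. inner_corner ls u})"

definition outer_contents :: "nat list \<Rightarrow> int list" where
  "outer_contents ls = sorted_list_of_set (content ` {u. outer_corner ls u})"

definition region_I :: "nat list \<Rightarrow> cell set" where
  "region_I ls = {u \<in> diagram ls. content u \<in> set (inner_contents ls)}"

definition region_O :: "nat list \<Rightarrow> cell set" where
  "region_O ls = {u \<in> diagram ls. content u \<in> set (outer_contents ls)}"

definition region_A :: "nat list \<Rightarrow> cell set" where
  "region_A ls = {u \<in> diagram ls.
     content u < outer_contents ls ! 0 \<or>
     (\<exists>k < length (inner_contents ls).
        inner_contents ls ! k < content u \<and> content u < outer_contents ls ! Suc k)}"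

definition region_B :: "nat list \<Rightarrow> cell set" where
  "region_B ls = {u \<in> diagram ls.
     (\<exists>k < length (inner_contents ls).
        outer_contents ls ! k < content u \<and> content u < inner_contents ls ! k) \<or>
     outer_contents ls ! length (inner_contents ls) < content u}"

text \<open>
  A filling of the diagram is a total function of which only the values on the diagram matter:
  it is always read through \<open>ext\<close>, which imposes the boundary conventions.
\<close>

definition ext :: "nat list \<Rightarrow> (cell \<Rightarrow> nat) \<Rightarrow> cell \<Rightarrow> enat" where
  "ext ls \<pi> u =
     (if fst u \<le> 0 \<or> snd u \<le> 0 then 0
      else if u \<in> diagram ls then enat (\<pi> u)
      else \<infinity>)"

definition rpp :: "nat list \<Rightarrow> (cell \<Rightarrow> nat) \<Rightarrow> bool" where
  "rpp ls \<pi> \<longleftrightarrow>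
     (\<forall>u \<in> diagram ls.
        ext ls \<pi> u \<le> ext ls \<pi> (east u) \<and> ext ls \<pi> u \<le> ext ls \<pi> (south u))"

definition content_le :: "cell \<Rightarrow> cell \<Rightarrow> bool" (infix "\<unlhd>\<^sub>c" 50) where
  "u \<unlhd>\<^sub>c v \<longleftrightarrow> content u > content v \<or> (content u = content v \<and> fst u \<ge> fst v)"

definition content_less :: "cell \<Rightarrow> cell \<Rightarrow> bool" (infix "\<lhd>\<^sub>c" 50) where
  "u \<lhd>\<^sub>c v \<longleftrightarrow> u \<unlhd>\<^sub>c v \<and> u \<noteq> v"

definition cand :: "nat list \<Rightarrow> (cell \<Rightarrow> nat) \<Rightarrow> cell set" where
  "cand ls \<pi> =
     {u \<in> region_O ls. ext ls \<pi> u > ext ls \<pi> (west u)} \<union>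
     {u \<in> region_A ls. ext ls \<pi> u > ext ls \<pi> (west u) \<and> ext ls \<pi> u > ext ls \<pi> (north u)}"

definition ne_path :: "nat list \<Rightarrow> cell list \<Rightarrow> bool" where
  "ne_path ls p \<longleftrightarrow>
     p \<noteq> [] \<and> set p \<subseteq> diagram ls \<and>
     (\<forall>k. Suc k < length p \<longrightarrow> p ! Suc k = north (p ! k) \<or> p ! Suc k = east (p ! k))"

text \<open>The length of a path is its number of steps.\<close>

definition path_length :: "cell list \<Rightarrow> nat" where
  "path_length p = length p - 1"

text \<open>
  The head \<open>\<alpha>\<close> of a path is its south-west end and the tail \<open>\<omega>\<close> its north-east end,
  whichever way the path is traversed.
\<close>

definition ne_head :: "cell list \<Rightarrow> cell" where "ne_head p = hd p"
definition ne_tail :: "cell list \<Rightarrow> cell" where "ne_tail p = last p"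
definition sw_head :: "cell list \<Rightarrow> cell" where "sw_head p = last p"

definition rim_hook :: "nat list \<Rightarrow> cell list \<Rightarrow> bool" where
  "rim_hook ls h \<longleftrightarrow>
     ne_path ls h \<and>
     south (ne_head h) \<notin> diagram ls \<and>
     east (ne_tail h) \<notin> diagram ls \<and>
     (\<forall>u \<in> set h. east (south u) \<notin> diagram ls)"

definition add_path :: "(cell \<Rightarrow> nat) \<Rightarrow> cell list \<Rightarrow> cell \<Rightarrow> nat" where
  "add_path \<pi> p u = (if u \<in> set p then \<pi> u + 1 else \<pi> u)"

definition compatible :: "nat list \<Rightarrow> cell list \<Rightarrow> (cell \<Rightarrow> nat) \<Rightarrow> bool" where
  "compatible ls p \<pi> \<longleftrightarrow>
     (\<forall>u \<in> set p \<inter> (region_I ls \<union> region_A ls).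
        east u \<in> set p \<and> ext ls \<pi> u = ext ls \<pi> (east u)) \<and>
     (\<forall>u. u \<in> set p \<and> south u \<in> set p \<longrightarrow> ext ls \<pi> u = ext ls \<pi> (south u))"

text \<open>
  The inserted path lies in the diagram; traversing it north-eastwards loses nothing, as
  the condition depends only on its cells, its length and its tail.
\<close>

definition inserts :: "nat list \<Rightarrow> cell list \<Rightarrow> (cell \<Rightarrow> nat) \<Rightarrow> bool" where
  "inserts ls h \<pi> \<longleftrightarrow>
     (\<exists>p. ne_path ls p \<and> ne_tail p = ne_tail h \<and> path_length p = path_length h \<and>
          compatible ls p \<pi> \<and> rpp ls (add_path \<pi> p))"

definition sw_step :: "nat list \<Rightarrow> (cell \<Rightarrow> nat) \<Rightarrow> cell \<Rightarrow> cell" where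
  "sw_step ls \<pi> u =
     (if u \<in> region_B ls \<union> region_I ls \<and> ext ls \<pi> u = ext ls \<pi> (south u)
      then south u else west u)"

text \<open>
  The path \<open>P(h, \<pi>)\<close>. It always makes as many steps as \<open>h\<close> and may leave the diagram
  through the first column, after which it continues westwards in \<open>\<int> \<times> \<int>\<close>.
  Stopping it at the boundary instead would be wrong: for the shape \<open>[1, 1]\<close> with entries
  0, 1 from top to bottom and the rim-hook consisting of both cells, the only candidate
  \<open>(2, 1)\<close> precedes \<open>(1, 0)\<close> but not \<open>(1, 1)\<close> in the content order.
\<close>

definition hook_path :: "nat list \<Rightarrow> cell list \<Rightarrow> (cell \<Rightarrow> nat) \<Rightarrow> cell list" where
  "hook_path ls h \<pi> =
     map (\<lambda>k. (sw_step ls \<pi> ^^ k) (ne_tail h)) [0..<Suc (path_length h)]"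

end

theory Submission
  imports Defs
begin

text \<open>
  If no candidate precedes the head of \<open>P = P(h, \<pi>)\<close>, then \<open>P\<close> itself can be inserted.
  Absence of candidates forces \<open>\<pi>(w u) = \<pi>(u)\<close> for all \<open>u\<close> in \<open>\<A>\<close> and \<open>\<O>\<close>
  whose content exceeds that of the head, which in turn propagates the invariant
  \<open>\<pi>(v) < \<pi>(e s v)\<close> along \<open>P\<close>. This single inequality implies that \<open>\<pi> + P\<close> is again a
  reverse plane partition. Were \<open>P\<close> to leave the diagram through the first column, the entry
  below its last cell would be positive and a candidate would occur further down that column.

  The regions are read off the boundary word: with north or east steps \<open>N\<close>, \<open>E\<close> before and
  after the last cell of a diagonal, \<open>\<O>\<close> is \<open>EN\<close>, \<open>\<I>\<close> is \<open>NE\<close>, \<open>\<A>\<close> is \<open>EE\<close> and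
  \<open>\<B>\<close> is \<open>NN\<close>.
\<close>

section \<open>The boundary of a Young diagram\<close>

lemma diagram_down_closed:
  assumes "is_partition ls" "(i, j) \<in> diagram ls" "1 \<le> i'" "i' \<le> i" "1 \<le> j'" "j' \<le> j"
  shows "(i', j') \<in> diagram ls"
proof -
  have ij: "1 \<le> i" "i \<le> int (length ls)" "1 \<le> j" "j \<le> int (ls ! nat (i - 1))"
    using assms(2) by (auto simp: diagram_def)
  have "ls ! nat (i - 1) \<le> ls ! nat (i' - 1)"
  proof (cases "i' = i")
    case False
    then show ?thesis
      using assms ij sorted_wrt_nth_less[of "(\<ge>)" ls "nat (i' - 1)" "nat (i - 1)"]
      by (auto simp: is_partition_def)
  qed simp
  then show ?thesis using assms ij by (auto simp: diagram_def)
qed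

lemma finite_diagram: "finite (diagram ls)"
proof (rule finite_subset)
  show "diagram ls \<subseteq> {1..int (length ls)} \<times> {1..int (sum_list ls)}"
  proof
    fix u assume "u \<in> diagram ls"
    then obtain i j where u: "u = (i, j)" "1 \<le> i" "i \<le> int (length ls)" "1 \<le> j"
      "j \<le> int (ls ! nat (i - 1))"
      by (auto simp: diagram_def)
    have "ls ! nat (i - 1) \<le> sum_list ls"
      using u by (intro member_le_sum_list nth_mem) auto
    then show "u \<in> {1..int (length ls)} \<times> {1..int (sum_list ls)}" using u by auto
  qed
qed simp

lemma diagram_pos: "u \<in> diagram ls \<Longrightarrow> 1 \<le> fst u \<and> 1 \<le> snd u"
  by (auto simp: diagram_def)

lemma diagram_mono:
  assumes "is_partition ls" "v \<in> diagram ls" "1 \<le> fst u" "fst u \<le> fst v" "1 \<le> snd u" "snd u \<le> snd v"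
  shows "u \<in> diagram ls"
  using diagram_down_closed[of ls "fst v" "snd v" "fst u" "snd u"] assms by simp

text \<open>
  Follow the boundary from south-west to north-east. The step leaving the last cell of content
  \<open>c\<close> goes north iff \<open>north_step ls c\<close>; beyond the diagram it is eastwards on the
  south-western side and northwards on the north-eastern side.
\<close>

definition north_step :: "nat list \<Rightarrow> int \<Rightarrow> bool" where
  "north_step ls c \<longleftrightarrow>
     (\<forall>u \<in> diagram ls. content u < c) \<or> (\<exists>u \<in> diagram ls. content u = c \<and> east u \<notin> diagram ls)"

lemmas cell_defs = north_def east_def south_def west_def content_def

text \<open>Cells on one diagonal are comparable in both coordinates. Hence a cell \<open>x\<close>
  of the previous diagonal without eastern neighbour cannot coexist with a corner \<open>u\<close>:
  depending on which of them lies lower, the diagram would contain \<open>east x\<close> or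
  \<open>south u\<close>.\<close>

lemma outer_corner_content_iff:
  assumes P: "is_partition ls"
  shows "c \<in> content ` {u. outer_corner ls u} \<longleftrightarrow> \<not> north_step ls (c - 1) \<and> north_step ls c"
proof
  assume "c \<in> content ` {u. outer_corner ls u}"
  then obtain u where u: "u \<in> diagram ls" "east u \<notin> diagram ls" "south u \<notin> diagram ls" "content u = c"
    by (auto simp: outer_corner_def)
  have "False" if x: "x \<in> diagram ls" "content x = c - 1" "east x \<notin> diagram ls" for x
  proof (cases "fst x \<le> fst u")
    case True
    then have "east x \<in> diagram ls"
      using diagram_mono[OF P u(1), of "east x"] diagram_pos[OF x(1)] x(2) u(4)
      by (auto simp: cell_defs)
    then show False using x by simp
  next
    case False
    then have "south u \<in> diagram ls"
      using diagram_mono[OF P x(1), of "south u"] diagram_pos[OF u(1)] x(2) u(4)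
      by (auto simp: cell_defs)
    then show False using u by simp
  qed
  moreover have "\<not> content u < c - 1" using u by simp
  ultimately show "\<not> north_step ls (c - 1) \<and> north_step ls c"
    using u unfolding north_step_def by blast
next
  assume N: "\<not> north_step ls (c - 1) \<and> north_step ls c"
  \<comment> \<open>The default north steps beyond the diagram create no corner, since the diagonal
    of largest content already ends with a north step.\<close>
  have "\<not> (\<forall>u \<in> diagram ls. content u < c)"
  proof
    assume all: "\<forall>u \<in> diagram ls. content u < c"
    obtain u where u: "u \<in> diagram ls" "\<not> content u < c - 1"
      using N by (auto simp: north_step_def)
    then have "content u = c - 1" using all by force
    moreover have "east u \<notin> diagram ls" using all calculation by (force simp: cell_defs)
    ultimately show False using N u by (auto simp: north_step_def)
  qed
  then obtain u where u: "u \<in> diagram ls" "content u = c" "east u \<notin> diagram ls"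
    using N by (auto simp: north_step_def)
  have "south u \<notin> diagram ls"
  proof
    assume s: "south u \<in> diagram ls"
    have "east (south u) \<in> diagram ls"
      using N s u by (auto simp: north_step_def cell_defs)
    then have "east u \<in> diagram ls"
      using diagram_mono[OF P, of "east (south u)" "east u"] diagram_pos[OF u(1)]
      by (auto simp: cell_defs)
    then show False using u by simp
  qed
  then show "c \<in> content ` {u. outer_corner ls u}"
    using u by (auto simp: outer_corner_def)
qed

lemma inner_corner_content_iff:
  assumes P: "is_partition ls"
  shows "c \<in> content ` {u. inner_corner ls u} \<longleftrightarrow> north_step ls (c - 1) \<and> \<not> north_step ls c"
proof
  assume "c \<in> content ` {u. inner_corner ls u}"
  then obtain u where u: "east u \<in> diagram ls" "south u \<in> diagram ls" "east (south u) \<notin> diagram ls"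
    "content u = c"
    by (auto simp: inner_corner_def)
  have "False" if x: "x \<in> diagram ls" "content x = c" "east x \<notin> diagram ls" for x
  proof (cases "fst x \<le> fst u")
    case True
    then have "east x \<in> diagram ls"
      using diagram_mono[OF P u(1), of "east x"] diagram_pos[OF x(1)] x(2) u(4)
      by (auto simp: cell_defs)
    then show False using x by simp
  next
    case False
    then have "east (south u) \<in> diagram ls"
      using diagram_mono[OF P x(1), of "east (south u)"] diagram_pos[OF u(1)] diagram_pos[OF u(2)]
        x(2) u(4)
      by (auto simp: cell_defs)
    then show False using u by simp
  qed
  moreover have "\<not> content (east u) < c" "content (south u) = c - 1"
    using u by (auto simp: cell_defs)
  ultimately show "north_step ls (c - 1) \<and> \<not> north_step ls c"
    using u unfolding north_step_def by blast
next
  assume N: "north_step ls (c - 1) \<and> \<not> north_step ls c"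
  then obtain y where y: "y \<in> diagram ls" "\<not> content y < c" by (auto simp: north_step_def)
  then obtain x where x: "x \<in> diagram ls" "content x = c - 1" "east x \<notin> diagram ls"
    using N unfolding north_step_def by force
  \<comment> \<open>The corner will be \<open>north x\<close>. Row 1 is excluded because the content
    of \<open>y\<close> is at least \<open>c\<close>, which forces row 1 to continue past
    \<open>x\<close>.\<close>
  have "fst x \<noteq> 1"
  proof
    assume "fst x = 1"
    then have "east x \<in> diagram ls"
      using diagram_mono[OF P y(1), of "east x"] diagram_pos[OF x(1)] diagram_pos[OF y(1)] x(2) y(2)
      by (auto simp: cell_defs)
    then show False using x by simp
  qed
  then have "north x \<in> diagram ls"
    using diagram_mono[OF P x(1), of "north x"] diagram_pos[OF x(1)] by (auto simp: cell_defs)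
  moreover have "content (north x) = c" using x by (simp add: cell_defs)
  ultimately have "east (north x) \<in> diagram ls" using N by (auto simp: north_step_def)
  moreover have "south (north x) = x" by (simp add: cell_defs)
  ultimately have "inner_corner ls (north x)" using x by (simp add: inner_corner_def)
  then show "c \<in> content ` {u. inner_corner ls u}"
    using \<open>content (north x) = c\<close> by auto
qed

lemma finite_outer_corners: "finite (content ` {u. outer_corner ls u})"
  by (rule finite_imageI, rule finite_subset[OF _ finite_diagram[of ls]]) (auto simp: outer_corner_def)

lemma finite_inner_corners: "finite (content ` {u. inner_corner ls u})"
proof (rule finite_imageI, rule finite_subset)
  show "{u. inner_corner ls u} \<subseteq> west ` diagram ls"
  proof
    fix u assume "u \<in> {u. inner_corner ls u}"
    then have "east u \<in> diagram ls" "u = west (east u)" by (auto simp: inner_corner_def cell_defs)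
    then show "u \<in> west ` diagram ls" by blast
  qed
qed (simp add: finite_diagram)

section \<open>Corner counts and the four regions\<close>

definition count_below :: "int set \<Rightarrow> int \<Rightarrow> nat" where
  "count_below S c = card {x \<in> S. x < c}"

lemma count_below_Suc:
  assumes "finite S"
  shows "count_below S (c + 1) = count_below S c + of_bool (c \<in> S)"
proof (cases "c \<in> S")
  case True
  then have "{x \<in> S. x < c + 1} = insert c {x \<in> S. x < c}" by auto
  then show ?thesis using True assms by (simp add: count_below_def)
next
  case False
  then have "{x \<in> S. x < c + 1} = {x \<in> S. x < c}" using zless_add1_eq by auto
  then show ?thesis using False by (simp add: count_below_def)
qed

lemma sorted_nth_less_iff:
  fixes xs :: "'a :: linorder list"
  assumes "sorted xs" "k < length xs"
  shows "xs ! k < c \<longleftrightarrow> k < length (filter (\<lambda>x. x < c) xs)"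
  using assms
proof (induction xs arbitrary: k)
  case (Cons x xs)
  show ?case
  proof (cases "x < c")
    case True
    then show ?thesis using Cons by (cases k) auto
  next
    case False
    then have "filter (\<lambda>x. x < c) (x # xs) = []" using Cons.prems by (auto simp: filter_empty_conv)
    moreover have "\<not> (x # xs) ! k < c"
      using nth_mem[OF Cons.prems(2)] False Cons.prems(1) by auto
    ultimately show ?thesis by simp
  qed
qed simp

text \<open>Turns comparisons with the \<open>k\<close>-th corner content into comparisons of
  \<open>k\<close> with a count, so that interlacing becomes arithmetic.\<close>

lemma nth_sorted_list_of_set_less_iff:
  assumes "finite S" "k < card S"
  shows "sorted_list_of_set S ! k < c \<longleftrightarrow> k < count_below S c"
proof -
  have "length (filter (\<lambda>x. x < c) (sorted_list_of_set S)) = count_below S c"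
    using assms distinct_card[of "filter (\<lambda>x. x < c) (sorted_list_of_set S)"]
    by (simp add: count_below_def Collect_conj_eq Int_commute)
  then show ?thesis using assms by (simp add: sorted_nth_less_iff)
qed

text \<open>
  Interlacing in the form of counts: along the boundary word, which starts with east steps,
  the turns \<open>EN\<close> and \<open>NE\<close> alternate.
\<close>

lemma corner_counts:
  assumes P: "is_partition ls" and u: "u \<in> diagram ls" and c: "c \<ge> - int (length ls)"
  shows "count_below (content ` {u. outer_corner ls u}) c =
         count_below (content ` {u. inner_corner ls u}) c + of_bool (north_step ls (c - 1))"
  using c
proof (induction c rule: int_ge_induct)
  case base
  \<comment> \<open>Both counts therefore start at 0, and the step before the start is the default
    east step.\<close>
  have low: "- int (length ls) < content x" if "x \<in> diagram ls" for x
    using that by (auto simp: diagram_def content_def)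
  have "{x \<in> content ` {u. outer_corner ls u}. x < - int (length ls)} = {}"
    using low by (force simp: outer_corner_def)
  moreover have "{x \<in> content ` {u. inner_corner ls u}. x < - int (length ls)} = {}"
    using low by (force simp: inner_corner_def cell_defs)
  moreover have "\<not> north_step ls (- int (length ls) - 1)"
  proof -
    have "\<not> content u < - int (length ls) - 1" using low[OF u] by simp
    moreover have "content x \<noteq> - int (length ls) - 1" if "x \<in> diagram ls" for x
      using low[OF that] by simp
    ultimately show ?thesis using u unfolding north_step_def by blast
  qed
  ultimately show ?case by (simp only: count_below_def) simp
next
  case (step c)
  then show ?case
    using outer_corner_content_iff[OF P, of c] inner_corner_content_iff[OF P, of c]
    by (simp add: count_below_Suc finite_outer_corners finite_inner_corners split: if_splits)
qed

lemma card_outer_corners: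
  assumes P: "is_partition ls" and u: "u \<in> diagram ls"
  shows "card (content ` {u. outer_corner ls u}) = Suc (card (content ` {u. inner_corner ls u}))"
proof -
  let ?O = "content ` {u. outer_corner ls u}" and ?I = "content ` {u. inner_corner ls u}"
  let ?X = "insert 0 (?O \<union> ?I \<union> content ` diagram ls)"
  \<comment> \<open>Beyond all contents both counts are complete. The offset 2 puts
    \<open>c - 1\<close> above every content as well, so the step there is north; the inserted 0
    makes \<open>c\<close> positive, hence admissible in \<open>corner_counts\<close>.\<close>
  define c where "c = Max ?X + 2"
  have fin: "finite ?X" by (simp add: finite_outer_corners finite_inner_corners finite_diagram)
  have lt: "x < c - 1" if "x \<in> ?X" for x
    using Max_ge[OF fin that] unfolding c_def by linarith
  have "c > 0" using lt[OF insertI1] by linarith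
  have O: "x < c" if "x \<in> ?O" for x
    using lt[OF insertI2[OF UnI1[OF UnI1[OF that]]]] by linarith
  have I: "x < c" if "x \<in> ?I" for x
    using lt[OF insertI2[OF UnI1[OF UnI2[OF that]]]] by linarith
  have D: "content y < c - 1" if "y \<in> diagram ls" for y
    using lt[OF insertI2[OF UnI2[OF imageI[OF that]]]] .
  have "{x \<in> ?O. x < c} = ?O" "{x \<in> ?I. x < c} = ?I" using O I by blast+
  moreover have "north_step ls (c - 1)" using D unfolding north_step_def by blast
  ultimately show ?thesis
    using corner_counts[OF P u, of c] \<open>c > 0\<close> by (simp add: count_below_def)
qed

text \<open>The corner counts below \<open>c\<close> and below \<open>c + 1\<close> differ by the
  turn at \<open>c\<close>, and interlacing ties them to the two boundary steps. The intervals
  defining \<A> and \<B> reduce to inequalities between these counts.\<close>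

lemma regions_iff:
  assumes P: "is_partition ls" and u: "u \<in> diagram ls"
  defines "c \<equiv> content u"
  shows "u \<in> region_O ls \<longleftrightarrow> \<not> north_step ls (c - 1) \<and> north_step ls c"
    and "u \<in> region_I ls \<longleftrightarrow> north_step ls (c - 1) \<and> \<not> north_step ls c"
    and "u \<in> region_A ls \<longleftrightarrow> \<not> north_step ls (c - 1) \<and> \<not> north_step ls c"
    and "u \<in> region_B ls \<longleftrightarrow> north_step ls (c - 1) \<and> north_step ls c"
proof -
  let ?O = "content ` {u. outer_corner ls u}" and ?I = "content ` {u. inner_corner ls u}"
  note fin = finite_outer_corners[of ls] finite_inner_corners[of ls]
  note iff = outer_corner_content_iff[OF P, of c] inner_corner_content_iff[OF P, of c]
  show "u \<in> region_O ls \<longleftrightarrow> \<not> north_step ls (c - 1) \<and> north_step ls c"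
    using u iff fin by (simp add: region_O_def outer_contents_def c_def)
  show "u \<in> region_I ls \<longleftrightarrow> north_step ls (c - 1) \<and> \<not> north_step ls c"
    using u iff fin by (simp add: region_I_def inner_contents_def c_def)
  define r where "r = card ?I"
  have len: "card ?O = Suc r" using card_outer_corners[OF P u] by (simp add: r_def)
  have low: "c \<ge> - int (length ls)" using u by (auto simp: c_def diagram_def content_def)
  let ?o = "count_below ?O c" and ?i = "count_below ?I c"
  let ?o' = "count_below ?O (c + 1)" and ?i' = "count_below ?I (c + 1)"
  have cnt: "?o = ?i + of_bool (north_step ls (c - 1))" "?o' = ?i' + of_bool (north_step ls c)"
    using corner_counts[OF P u, of c] corner_counts[OF P u, of "c + 1"] low by auto
  have suc: "?o' = ?o + of_bool (\<not> north_step ls (c - 1) \<and> north_step ls c)"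
    "?i' = ?i + of_bool (north_step ls (c - 1) \<and> \<not> north_step ls c)"
    using count_below_Suc[OF fin(1), of c] count_below_Suc[OF fin(2), of c] iff by auto
  have bnd: "?i' \<le> r" "?o' \<le> Suc r"
    unfolding r_def count_below_def len[unfolded r_def, symmetric]
    using fin by (auto intro!: card_mono)
  have o: "outer_contents ls ! k < d \<longleftrightarrow> k < count_below ?O d" if "k \<le> r" for k d
    unfolding outer_contents_def
    using that fin len by (intro nth_sorted_list_of_set_less_iff) auto
  have i: "inner_contents ls ! k < d \<longleftrightarrow> k < count_below ?I d" if "k < r" for k d
    unfolding inner_contents_def
    using that fin by (intro nth_sorted_list_of_set_less_iff) (auto simp: r_def)
  have o': "c < outer_contents ls ! k \<longleftrightarrow> ?o' \<le> k" if "k \<le> r" for k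
    using o[OF that, of "c + 1"] by linarith
  have i': "c < inner_contents ls ! k \<longleftrightarrow> ?i' \<le> k" if "k < r" for k
    using i[OF that, of "c + 1"] by linarith
  have lenI: "length (inner_contents ls) = r" by (simp add: inner_contents_def r_def)
  have "u \<in> region_A ls \<longleftrightarrow> ?o' = 0 \<or> (\<exists>k<r. k < ?i \<and> ?o' \<le> Suc k)"
    unfolding region_A_def lenI using u o' i by (auto simp flip: c_def)
  also have "\<dots> \<longleftrightarrow> \<not> north_step ls (c - 1) \<and> \<not> north_step ls c"
  proof
    assume "?o' = 0 \<or> (\<exists>k<r. k < ?i \<and> ?o' \<le> Suc k)"
    then show "\<not> north_step ls (c - 1) \<and> \<not> north_step ls c"
      using cnt suc by (cases "north_step ls (c - 1)"; cases "north_step ls c") auto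
  next
    assume N: "\<not> north_step ls (c - 1) \<and> \<not> north_step ls c"
    show "?o' = 0 \<or> (\<exists>k<r. k < ?i \<and> ?o' \<le> Suc k)"
    proof (cases ?o')
      case (Suc m)
      \<comment> \<open>Here \<open>?o' = ?o = ?i = Suc m\<close>, so \<open>m\<close> is the index
        of the last inner corner before \<open>c\<close>.\<close>
      then have "m < r \<and> m < ?i \<and> ?o' \<le> Suc m" using N cnt suc bnd by simp
      then show ?thesis by blast
    qed simp
  qed
  finally show "u \<in> region_A ls \<longleftrightarrow> \<not> north_step ls (c - 1) \<and> \<not> north_step ls c" .
  have "u \<in> region_B ls \<longleftrightarrow> (\<exists>k<r. k < ?o \<and> ?i' \<le> k) \<or> r < ?o"
    unfolding region_B_def lenI using u o i' by (auto simp flip: c_def)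
  also have "\<dots> \<longleftrightarrow> north_step ls (c - 1) \<and> north_step ls c"
  proof
    assume "(\<exists>k<r. k < ?o \<and> ?i' \<le> k) \<or> r < ?o"
    then show "north_step ls (c - 1) \<and> north_step ls c"
      using cnt suc bnd by (cases "north_step ls (c - 1)"; cases "north_step ls c") auto
  next
    assume N: "north_step ls (c - 1) \<and> north_step ls c"
    then have "?o = Suc ?i" "?i' = ?i" using cnt suc by auto
    \<comment> \<open>The index \<open>?i\<close> belongs to the next inner corner; if there is
      none, \<open>c\<close> lies beyond the last outer corner.\<close>
    then show "(\<exists>k<r. k < ?o \<and> ?i' \<le> k) \<or> r < ?o"
      using bnd by (cases "?i < r") auto
  qed
  finally show "u \<in> region_B ls \<longleftrightarrow> north_step ls (c - 1) \<and> north_step ls c" .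
qed

section \<open>Reverse plane partitions without early candidates\<close>

lemma ext_diagram: "u \<in> diagram ls \<Longrightarrow> ext ls \<pi> u = enat (\<pi> u)"
  using diagram_pos[of u ls] by (simp add: ext_def)

text \<open>The boundary values 0 and \<infinity> keep the order outside the diagram, so neighbours
  can be compared without checking where they lie.\<close>

lemma ext_south_east_mono:
  assumes P: "is_partition ls" and R: "rpp ls \<pi>"
  shows "ext ls \<pi> u \<le> ext ls \<pi> (east u)" "ext ls \<pi> u \<le> ext ls \<pi> (south u)"
proof -
  have "ext ls \<pi> u \<le> ext ls \<pi> (east u) \<and> ext ls \<pi> u \<le> ext ls \<pi> (south u)"
  proof (cases "u \<in> diagram ls")
    case True
    then show ?thesis using R by (auto simp: rpp_def)
  next
    case False
    show ?thesis
    proof (cases "fst u \<le> 0 \<or> snd u \<le> 0")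
      case True
      then show ?thesis by (simp add: ext_def)
    next
      case pos: False
      then have "east u \<notin> diagram ls" "south u \<notin> diagram ls"
        using False diagram_mono[OF P, of _ u] by (force simp: cell_defs)+
      then show ?thesis using pos by (simp add: ext_def cell_defs)
    qed
  qed
  then show "ext ls \<pi> u \<le> ext ls \<pi> (east u)" "ext ls \<pi> u \<le> ext ls \<pi> (south u)" by auto
qed

text \<open>A non-candidate in \<O> cannot exceed its western neighbour. In \<A> it may instead be
  bounded by \<open>north v\<close>; that cell is again in \<A> or \<O>, since its incoming boundary
  step is the outgoing one of \<open>v\<close>, and induction on the row passes the bound on to
  \<open>west (north v)\<close> and then to \<open>west v\<close>.\<close>

lemma ext_west_eq:
  assumes P: "is_partition ls" and R: "rpp ls \<pi>"
    and no_cand: "\<And>x. x \<in> cand ls \<pi> \<Longrightarrow> content x \<le> m"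
    and "v \<in> diagram ls" "\<not> north_step ls (content v - 1)" "m < content v"
  shows "ext ls \<pi> (west v) = ext ls \<pi> v"
  using assms(4-6)
proof (induction "nat (fst v)" arbitrary: v rule: less_induct)
  case less
  have ge: "ext ls \<pi> (west v) \<le> ext ls \<pi> v"
    using ext_south_east_mono(1)[OF P R, of "west v"] by (simp add: cell_defs)
  have "v \<notin> cand ls \<pi>" using no_cand[of v] less.prems by auto
  then consider "ext ls \<pi> v \<le> ext ls \<pi> (west v)" |
    "ext ls \<pi> v \<le> ext ls \<pi> (north v)" "\<not> north_step ls (content v)"
    using regions_iff[OF P less.prems(1)] less.prems(2) by (auto simp: cand_def not_less)
  then show ?case
  proof cases
    case 1
    then show ?thesis using ge by simp
  next
    case 2
    have pos: "1 \<le> fst v" "1 \<le> snd v" using diagram_pos less.prems(1) by auto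
    have "ext ls \<pi> (north v) \<le> ext ls \<pi> (west v)"
    proof (cases "fst v = 1")
      case True
      then show ?thesis by (simp add: ext_def north_def)
    next
      case False
      then have "north v \<in> diagram ls"
        using diagram_mono[OF P less.prems(1), of "north v"] pos by (simp add: cell_defs)
      then have "ext ls \<pi> (west (north v)) = ext ls \<pi> (north v)"
        using less.hyps[of "north v"] pos 2(2) less.prems(3) by (simp add: cell_defs)
      moreover have "ext ls \<pi> (west (north v)) \<le> ext ls \<pi> (west v)"
        using ext_south_east_mono(2)[OF P R, of "west (north v)"] by (simp add: cell_defs)
      ultimately show ?thesis by simp
    qed
    then show ?thesis using 2 ge by simp
  qed
qed

text \<open>The cell \<open>east (south v)\<close> shares the diagonal of \<open>v\<close>, so the
  content bound does not cover it and it is excluded separately. As a non-candidate it is bounded by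
  \<open>south v\<close>, or, in \<A>, by \<open>east v\<close>, whose entry equals that of
  \<open>v\<close> and is too small.\<close>

lemma ext_south_gt:
  assumes P: "is_partition ls" and R: "rpp ls \<pi>"
    and no_cand: "\<And>x. x \<in> cand ls \<pi> \<Longrightarrow> content x \<le> content v"
    and es: "east (south v) \<notin> cand ls \<pi>"
    and v: "v \<in> diagram ls" "\<not> north_step ls (content v - 1)"
    and gt: "ext ls \<pi> v < ext ls \<pi> (east (south v))"
  shows "ext ls \<pi> v < ext ls \<pi> (south v)"
proof (cases "south v \<in> diagram ls")
  case False
  then show ?thesis using v diagram_pos[OF v(1)] by (simp add: ext_def south_def)
next
  case True
  have cs: "content (south v) = content v - 1" "content (east (south v)) = content v"
    by (auto simp: cell_defs)
  have esD: "east (south v) \<in> diagram ls"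
    using True v(2) cs by (auto simp: north_step_def)
  have "ext ls \<pi> (east (south v)) \<le> ext ls \<pi> (west (east (south v))) \<or>
    \<not> north_step ls (content v) \<and> ext ls \<pi> (east (south v)) \<le> ext ls \<pi> (north (east (south v)))"
    using regions_iff[OF P esD] cs es v(2) by (auto simp: cand_def not_less)
  moreover have "west (east (south v)) = south v" "north (east (south v)) = east v"
    by (auto simp: cell_defs)
  moreover have "ext ls \<pi> (east v) = ext ls \<pi> v"
    if "\<not> north_step ls (content v)"
  proof -
    have "east v \<in> diagram ls" "content (east v) = content v + 1" "west (east v) = v"
      using v(1) that by (auto simp: north_step_def cell_defs)
    then show ?thesis
      using ext_west_eq[OF P R no_cand, of "east v"] that by simp
  qed
  ultimately show ?thesis using gt by auto
qed

text \<open>Walk down the column from \<open>x\<close>. Entries stay positive while their western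
  neighbours are 0, and the first cell entered by an east step, at the latest \<open>d\<close>, is a
  candidate.\<close>

lemma first_column_candidate:
  assumes P: "is_partition ls" and R: "rpp ls \<pi>"
    and d: "d \<in> diagram ls" "\<not> north_step ls (content d - 1)" "snd d = 1"
    and x: "snd x = 1" "1 \<le> fst x" "fst x \<le> fst d"
    and gt: "ext ls \<pi> (north x) < ext ls \<pi> x"
  shows "\<exists>y \<in> cand ls \<pi>. snd y = 1 \<and> content d \<le> content y"
proof -
  have D: "y \<in> diagram ls" if "snd y = 1" "1 \<le> fst y" "fst y \<le> fst d" for y
    using diagram_mono[OF P d(1), of y] d(3) that by simp
  have west0: "ext ls \<pi> (west y) = 0" if "snd y = 1" for y
    using that by (simp add: ext_def west_def)
  \<comment> \<open>Once a cell has an outgoing north step, the walk passes only through \<B> until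
    it meets \<O>, where no northern comparison is required. Only \<open>x\<close> itself can lie in
    \<A>, and there \<open>gt\<close> supplies that comparison.\<close>
  have down: "\<exists>y \<in> cand ls \<pi>. snd y = 1 \<and> content d \<le> content y"
    if "north_step ls (content y)" "snd y = 1" "1 \<le> fst y" "fst y \<le> fst d" "0 < ext ls \<pi> y" for y
    using that
  proof (induction "nat (fst d - fst y)" arbitrary: y rule: less_induct)
    case less
    note yD = D[OF less.prems(2-4)]
    show ?case
    proof (cases "north_step ls (content y - 1)")
      case False
      then have "y \<in> cand ls \<pi>"
        using regions_iff(1)[OF P yD] less.prems west0[of y] by (auto simp: cand_def)
      then show ?thesis using less.prems d(3) by (auto simp: content_def)
    next
      case True
      then have "y \<noteq> d" using d(2) by auto
      then have "fst y < fst d" using less.prems d(3) by (auto simp: prod_eq_iff)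
      moreover have "0 < ext ls \<pi> (south y)"
        using ext_south_east_mono(2)[OF P R, of y] less.prems(5) by (metis order_less_le_trans)
      ultimately show ?thesis
        using less.hyps[of "south y"] less.prems True by (simp add: cell_defs algebra_simps)
    qed
  qed
  note xD = D[OF x]
  have pos: "0 < ext ls \<pi> x" using gt by (metis gr_zeroI not_less_zero)
  show ?thesis
  proof (cases "north_step ls (content x)")
    case True
    then show ?thesis using down x pos by blast
  next
    case nN: False
    show ?thesis
    proof (cases "north_step ls (content x - 1)")
      case False
      then have "x \<in> cand ls \<pi>"
        using regions_iff(3)[OF P xD] nN gt west0[of x] x pos by (auto simp: cand_def)
      then show ?thesis using x d(3) by (auto simp: content_def)
    next
      case True
      then have "x \<noteq> d" using d(2) by auto
      then have "fst x < fst d" using x d(3) by (auto simp: prod_eq_iff)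
      moreover have "0 < ext ls \<pi> (south x)"
        using ext_south_east_mono(2)[OF P R, of x] pos by (metis order_less_le_trans)
      ultimately show ?thesis
        using down[of "south x"] x True by (simp add: cell_defs algebra_simps)
    qed
  qed
qed

section \<open>The south-west path\<close>

lemma sw_step_eq:
  assumes "is_partition ls" "v \<in> diagram ls"
  shows "sw_step ls \<pi> v =
    (if north_step ls (content v - 1) \<and> ext ls \<pi> v = ext ls \<pi> (south v) then south v else west v)"
  using regions_iff[OF assms] by (auto simp: sw_step_def)

lemma content_sw_step: "content (sw_step ls \<pi> v) = content v - 1"
  by (simp add: sw_step_def cell_defs)

lemma content_sw_path: "content ((sw_step ls \<pi> ^^ k) v) = content v - int k"
  by (induction k) (simp_all add: content_sw_step)

lemma content_ne_path:
  assumes "ne_path ls p" "k < length p"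
  shows "content (p ! k) = content (hd p) + int k"
  using assms(2)
proof (induction k)
  case 0
  then show ?case using assms by (simp add: hd_conv_nth ne_path_def)
next
  case (Suc k)
  then have "p ! Suc k = north (p ! k) \<or> p ! Suc k = east (p ! k)"
    using assms by (simp add: ne_path_def)
  then have "content (p ! Suc k) = content (p ! k) + 1" by (auto simp: cell_defs)
  then show ?case using Suc by simp
qed

text \<open>Applied to the head of a rim-hook, this places its diagonal in \<A> or \<O>. Rows are
  compared along a diagonal as for the corners.\<close>

lemma not_north_step_below_south_end:
  assumes P: "is_partition ls" and a: "a \<in> diagram ls" "south a \<notin> diagram ls"
  shows "\<not> north_step ls (content a - 1)"
proof
  assume "north_step ls (content a - 1)"
  then obtain x where x: "x \<in> diagram ls" "content x = content a - 1" "east x \<notin> diagram ls"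
    using a(1) by (force simp: north_step_def)
  show False
  proof (cases "fst x \<le> fst a")
    case True
    then show False
      using diagram_mono[OF P a(1), of "east x"] diagram_pos[OF x(1)] x by (auto simp: cell_defs)
  next
    case False
    then show False
      using diagram_mono[OF P x(1), of "south a"] diagram_pos[OF a(1)] a x by (auto simp: cell_defs)
  qed
qed

text \<open>The inequality starts from \<infinity> at \<open>w\<close>. A south step keeps the entry
  while the south-east neighbour can only grow. After a west step that neighbour is
  \<open>south (v k)\<close>, which exceeds \<open>v k\<close> by the step rule or by
  \<open>ext_south_gt\<close>.\<close>

lemma sw_path_in_diagram:
  fixes w :: cell and s :: nat
  assumes P: "is_partition ls" and R: "rpp ls \<pi>"
    and w: "w \<in> diagram ls" "east (south w) \<notin> diagram ls"
    and a: "a \<in> diagram ls" "\<not> north_step ls (content a - 1)" "content a = content w - int s"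
  defines "v \<equiv> \<lambda>k. (sw_step ls \<pi> ^^ k) w"
  assumes no_cand: "\<And>x. x \<in> cand ls \<pi> \<Longrightarrow> \<not> x \<lhd>\<^sub>c v s"
    and "k \<le> s"
  shows "v k \<in> diagram ls \<and> ext ls \<pi> (v k) < ext ls \<pi> (east (south (v k)))"
  using \<open>k \<le> s\<close>
proof (induction k)
  case 0
  have "1 \<le> fst w" "1 \<le> snd w" using diagram_pos[OF w(1)] by auto
  then have "ext ls \<pi> (east (south w)) = \<infinity>"
    using w(2) by (simp add: ext_def cell_defs)
  then show ?case using w by (simp add: v_def ext_diagram)
next
  case (Suc k)
  have IH: "v k \<in> diagram ls" "ext ls \<pi> (v k) < ext ls \<pi> (east (south (v k)))"
    using Suc by auto
  have cv: "content (v j) = content w - int j" for j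
    by (simp add: v_def content_sw_path)
  have nc: "content x \<le> content (v s)" if "x \<in> cand ls \<pi>" for x
    using no_cand[OF that] by (auto simp: content_less_def content_le_def)
  have vSuc: "v (Suc k) = sw_step ls \<pi> (v k)" by (simp add: v_def)
  have ck: "content (v s) < content (v k)" using Suc.prems by (simp add: cv)
  show ?case
  proof (cases "north_step ls (content (v k) - 1) \<and> ext ls \<pi> (v k) = ext ls \<pi> (south (v k))")
    case True
    then have eq: "v (Suc k) = south (v k)" by (simp add: vSuc sw_step_eq[OF P IH(1)])
    have "south (v k) \<in> diagram ls"
      using True IH(1) diagram_pos[OF IH(1)]
      by (cases "south (v k) \<in> diagram ls") (simp_all add: ext_diagram ext_def south_def)
    moreover have "ext ls \<pi> (east (south (v k))) \<le> ext ls \<pi> (east (south (south (v k))))"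
      using ext_south_east_mono(2)[OF P R, of "east (south (v k))"] by (simp add: cell_defs)
    ultimately show ?thesis using True IH(2) eq by auto
  next
    case False
    then have eq: "v (Suc k) = west (v k)"
      unfolding vSuc sw_step_eq[OF P IH(1)] by (rule if_not_P)
    have gt: "ext ls \<pi> (v k) < ext ls \<pi> (south (v k))"
    proof (cases "north_step ls (content (v k) - 1)")
      case True
      then show ?thesis
        using False ext_south_east_mono(2)[OF P R, of "v k"] by (simp add: order_less_le)
    next
      case nN: False
      have "east (south (v k)) \<notin> cand ls \<pi>"
        using nc[of "east (south (v k))"] ck by (auto simp: cell_defs)
      then show ?thesis
        using ext_south_gt[OF P R _ _ IH(1) nN IH(2)] nc ck by force
    qed
    have "snd (v k) \<noteq> 1"
    proof
      assume one: "snd (v k) = 1"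
      \<comment> \<open>The first-column cell on the diagonal of \<open>a\<close>, where the walk
        down the column must end.\<close>
      define d where "d = (1 - content a, 1 :: int)"
      have cd: "content d = content a" by (simp add: d_def content_def)
      have ca: "content a = content (v s)" using a by (simp add: cv)
      have fst: "1 \<le> fst (v k)" "fst (v k) < fst d"
        using diagram_pos[OF IH(1)] ck ca one by (auto simp: d_def content_def)
      then have "d \<in> diagram ls"
        using diagram_mono[OF P a(1), of d] diagram_pos[OF a(1)] by (auto simp: d_def content_def)
      moreover have "north (south (v k)) = v k" by (simp add: cell_defs)
      moreover have "snd (south (v k)) = 1" "fst (south (v k)) = fst (v k) + 1" "snd d = 1"
        using one by (simp_all add: south_def d_def)
      ultimately obtain y where y: "y \<in> cand ls \<pi>" "snd y = 1" "content (v s) \<le> content y"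
        using first_column_candidate[OF P R, of d "south (v k)"] a(2) cd ca fst gt
        by auto
      \<comment> \<open>Outside the diagram the path only moves west, so its end has column at most
        0. A first-column cell of at least the same content then precedes it in the content
        order.\<close>
      have west_col: "snd (sw_step ls \<pi> z) \<le> 0" if "snd z \<le> 0" for z
      proof -
        have "z \<notin> diagram ls" using that diagram_pos[of z ls] by auto
        then show ?thesis
          using that by (auto simp: sw_step_def region_B_def region_I_def west_def)
      qed
      have "snd (v j) \<le> 0" if "Suc k \<le> j" for j
        using that
      proof (induction j rule: dec_induct)
        case base
        then show ?case using eq one by (simp add: west_def)
      next
        case (step j)
        then show ?case using west_col[of "v j"] by (simp add: v_def)
      qed
      then have "snd (v s) \<le> 0" using Suc.prems by blast
      then have "y \<lhd>\<^sub>c v s" using y by (auto simp: content_less_def content_le_def content_def)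
      then show False using no_cand y by blast
    qed
    then have "west (v k) \<in> diagram ls"
      using diagram_mono[OF P IH(1), of "west (v k)"] diagram_pos[OF IH(1)] by (auto simp: west_def)
    moreover have "ext ls \<pi> (west (v k)) \<le> ext ls \<pi> (v k)"
      using ext_south_east_mono(1)[OF P R, of "west (v k)"] by (simp add: cell_defs)
    moreover have "east (south (west (v k))) = south (v k)" by (simp add: cell_defs)
    ultimately show ?thesis using gt eq by auto
  qed
qed

section \<open>Inserting the path\<close>

lemma rpp_add_path:
  assumes P: "is_partition ls" and R: "rpp ls \<pi>" and sub: "set p \<subseteq> diagram ls"
    and E: "\<And>u. u \<in> set p \<Longrightarrow> east u \<notin> set p \<Longrightarrow> ext ls \<pi> u < ext ls \<pi> (east u)"
    and S: "\<And>u. u \<in> set p \<Longrightarrow> south u \<notin> set p \<Longrightarrow> ext ls \<pi> u < ext ls \<pi> (south u)"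
  shows "rpp ls (add_path \<pi> p)"
proof -
  have ext': "ext ls (add_path \<pi> p) u = (if u \<in> set p then eSuc (ext ls \<pi> u) else ext ls \<pi> u)" for u
    using sub diagram_pos[of u ls] by (auto simp: ext_def add_path_def eSuc_enat)
  \<comment> \<open>Only a step from the path to a cell off it can break the order, and strictness
    there absorbs the added 1.\<close>
  have "ext ls (add_path \<pi> p) u \<le> ext ls (add_path \<pi> p) y"
    if "ext ls \<pi> u \<le> ext ls \<pi> y" "u \<in> set p \<Longrightarrow> y \<notin> set p \<Longrightarrow> ext ls \<pi> u < ext ls \<pi> y" for u y
    using that by (auto simp: ext' ileI1 intro: order_trans[OF _ ile_eSuc])
  then show ?thesis
    using E S ext_south_east_mono[OF P R] by (simp add: rpp_def)
qed

theorem mainTheorem5: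
  fixes ls :: "nat list" and \<pi> :: "cell \<Rightarrow> nat" and h :: "cell list"
  assumes "is_partition ls"
    and "rpp ls \<pi>"
    and "rim_hook ls h"
    and "\<not> inserts ls h \<pi>"
  shows "\<exists>u \<in> cand ls \<pi>. u \<lhd>\<^sub>c sw_head (hook_path ls h \<pi>)"
proof (rule ccontr)
  assume no: "\<not> ?thesis"
  note P = assms(1) and R = assms(2)
  define w where "w = ne_tail h"
  define s where "s = path_length h"
  define a where "a = ne_head h"
  define v where "v k = (sw_step ls \<pi> ^^ k) w" for k
  define p where "p = rev (hook_path ls h \<pi>)"
  have h: "ne_path ls h" "h \<noteq> []" "set h \<subseteq> diagram ls"
    using assms(3) by (auto simp: rim_hook_def ne_path_def)
  have w: "w \<in> diagram ls" "east (south w) \<notin> diagram ls"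
    using assms(3) h by (auto simp: rim_hook_def w_def ne_tail_def)
  have a: "a \<in> diagram ls" "south a \<notin> diagram ls"
    using assms(3) h by (auto simp: rim_hook_def a_def ne_head_def)
  have ca: "content a = content w - int s"
    using content_ne_path[OF h(1), of "length h - 1"] h(2)
    by (simp add: w_def s_def a_def ne_tail_def ne_head_def path_length_def last_conv_nth)
  note aN = not_north_step_below_south_end[OF P a]
  have path: "hook_path ls h \<pi> = map v [0..<Suc s]"
    by (simp add: hook_path_def v_def w_def s_def)
  have nc: "\<not> x \<lhd>\<^sub>c v s" if "x \<in> cand ls \<pi>" for x
    using no that by (simp add: path sw_head_def)
  have nc_content: "content x \<le> content (v s)" if "x \<in> cand ls \<pi>" for x
    using nc[OF that] by (auto simp: content_less_def content_le_def)
  have cv: "content (v k) = content w - int k" for k by (simp add: v_def content_sw_path)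
  have D: "v k \<in> diagram ls" "ext ls \<pi> (v k) < ext ls \<pi> (east (south (v k)))" if "k \<le> s" for k
    using sw_path_in_diagram[OF P R w a(1) aN ca _ that] nc by (auto simp: v_def)
  have setp: "set p = v ` {..s}" by (auto simp: p_def path simp del: upt_Suc)
  have step: "v (Suc k) = (if north_step ls (content (v k) - 1) \<and> ext ls \<pi> (v k) = ext ls \<pi> (south (v k))
      then south (v k) else west (v k))" if "k \<le> s" for k
    using sw_step_eq[OF P D(1)[OF that]] by (simp add: v_def)
  have ne: "ne_path ls p"
  proof -
    have "p ! Suc k = north (p ! k) \<or> p ! Suc k = east (p ! k)" if k: "Suc k < length p" for k
    proof -
      have "k < s" using k by (simp add: p_def path)
      then have "p ! Suc k = v (s - Suc k)" "p ! k = v (Suc (s - Suc k))"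
        by (simp_all add: p_def path rev_nth Suc_diff_Suc del: upt_Suc)
      then show ?thesis
        using step[of "s - Suc k"] by (auto simp: cell_defs)
    qed
    then show ?thesis using D by (auto simp: ne_path_def setp) (simp add: p_def path)
  qed
  have tail: "ne_tail p = ne_tail h"
    by (simp add: ne_tail_def p_def path last_rev hd_map v_def w_def del: upt_Suc)
  have len: "path_length p = path_length h"
    by (simp add: path_length_def p_def path s_def)
  have E: "ext ls \<pi> u < ext ls \<pi> (east u)" if "u \<in> set p" "east u \<notin> set p" for u
  proof -
    obtain k where k: "k \<le> s" "u = v k" using \<open>u \<in> set p\<close> setp by auto
    show ?thesis
    proof (cases k)
      case 0
      have "ext ls \<pi> (east w) = \<infinity>"
        using assms(3) diagram_pos[OF w(1)] by (simp add: rim_hook_def w_def ext_def cell_defs)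
      then show ?thesis using k 0 w by (simp add: v_def ext_diagram)
    next
      case (Suc j)
      have j: "j \<le> s" "v j \<in> set p" using Suc k setp by auto
      then have "v j \<noteq> east u" using that by auto
      \<comment> \<open>The path reached \<open>u\<close> by a south step, so \<open>east u\<close>
        is the south-east neighbour of \<open>v j\<close> and the invariant applies.\<close>
      then have "u = south (v j)" "ext ls \<pi> (v j) = ext ls \<pi> (south (v j))"
        using step[OF j(1)] Suc k by (auto simp: cell_defs split: if_splits)
      then show ?thesis using D(2)[OF j(1)] by simp
    qed
  qed
  have S: "ext ls \<pi> u < ext ls \<pi> (south u)" if "u \<in> set p" "south u \<notin> set p" for u
  proof -
    obtain k where k: "k \<le> s" "u = v k" using \<open>u \<in> set p\<close> setp by auto
    show ?thesis
    proof (cases "north_step ls (content u - 1)")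
      case True
      \<comment> \<open>The head has an incoming east step, so the path continues beyond
        \<open>u\<close>; as it avoids \<open>south u\<close>, the entries must differ.\<close>
      then have "k \<noteq> s" using aN ca k cv by auto
      then have "v (Suc k) \<in> set p" using k setp by auto
      then have "ext ls \<pi> u \<noteq> ext ls \<pi> (south u)" using step[of k] True k that by auto
      then show ?thesis using ext_south_east_mono(2)[OF P R, of u] by (simp add: order_less_le)
    next
      case False
      have "content x \<le> content u" if "x \<in> cand ls \<pi>" for x
        using nc_content[OF that] k by (simp add: cv)
      \<comment> \<open>Before the head the content alone excludes this cell; at the head it lies on
        the same diagonal in a lower row, hence still precedes it.\<close>
      moreover have "east (south u) \<notin> cand ls \<pi>"
      proof
        assume es: "east (south u) \<in> cand ls \<pi>"
        then have "k = s" using nc_content[OF es] k cv[of k] cv[of s] by (simp add: cell_defs)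
        then have "east (south u) \<lhd>\<^sub>c v s"
          using k by (auto simp: content_less_def content_le_def cell_defs prod_eq_iff)
        then show False using nc es by blast
      qed
      ultimately show ?thesis
        using ext_south_gt[OF P R _ _ _ False] D k by blast
    qed
  qed
  have "east u \<in> set p \<and> ext ls \<pi> u = ext ls \<pi> (east u)"
    if u: "u \<in> set p" "u \<in> region_I ls \<union> region_A ls" for u
  proof -
    obtain k where k: "k \<le> s" "u = v k" using u setp by auto
    \<comment> \<open>\<I> and \<A> are the diagonals left by an east step. This is the incoming
      step of the preceding path cell, so the path came from there by a west step.\<close>
    have N: "\<not> north_step ls (content u)"
      using regions_iff[OF P D(1)[OF k(1)]] u k by auto
    have "k \<noteq> 0"
    proof
      assume "k = 0"
      then have "u \<in> diagram ls" "east u \<notin> diagram ls"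
        using k w assms(3) by (auto simp: v_def w_def rim_hook_def)
      then show False using N by (auto simp: north_step_def)
    qed
    then obtain j where j: "k = Suc j" by (cases k) auto
    have js: "j < s" using j k by simp
    have cj: "content (v j) - 1 = content u" using k j by (simp add: cv)
    then have west: "u = west (v j)" using step[of j] js N k j by simp
    then have "ext ls \<pi> u = ext ls \<pi> (v j)"
      using ext_west_eq[OF P R nc_content D(1), of j] js N cj cv by simp
    moreover have "east u = v j" using west by (simp add: cell_defs)
    ultimately show ?thesis using setp js by auto
  qed
  moreover have "ext ls \<pi> u = ext ls \<pi> (south u)" if u: "u \<in> set p" "south u \<in> set p" for u
  proof -
    \<comment> \<open>The path meets each diagonal once, so \<open>south u\<close> is the cell right
      after \<open>u\<close>, and south steps are taken only between equal entries.\<close>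
    obtain j k where k: "k \<le> s" "u = v k" "j \<le> s" "south u = v j" using u setp by auto
    have "int j = int k + 1"
    proof -
      have "content (south u) = content u - 1" by (simp add: cell_defs)
      then show ?thesis using k cv[of j] cv[of k] by simp
    qed
    then have "j = Suc k" by simp
    then have "v (Suc k) = south (v k)" using k by simp
    moreover have "south (v k) \<noteq> west (v k)" by (simp add: south_def west_def)
    ultimately show ?thesis using step[OF k(1)] k by (auto split: if_splits)
  qed
  ultimately have "compatible ls p \<pi>" by (auto simp: compatible_def)
  moreover have "rpp ls (add_path \<pi> p)"
    using rpp_add_path[OF P R _ E S] ne by (auto simp: ne_path_def)
  ultimately have "inserts ls h \<pi>"
    unfolding inserts_def using ne tail len by blast
  then show False using assms(4) by simp
qed

end
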